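(* Let $D$ be a positive integer, let $W_1\ge W_2\ge\dots\ge W_D\ge 0$ be real numbers, let $K_a\ge 1$ be an integer, and let $\tilde\sigma^2>0$. Let $g$, $\psi$ and $\tilde\phi$ be the functions defined from these data in the context, and define $$\zeta(x)=\psi'(x)\,(\tilde\sigma^2x+1)-\tilde\sigma^2\psi(x),\qquad x\in[1,D].$$ Consider the problem of maximizing $\tilde\phi(S)$ over $S\in\{1,2,\dots,D\}$. This problem has a unique optimal solution, the optimal breathing depth $S^*$, and it is given as follows. (i) If $\zeta(1)\cdot\zeta(D)<0$, then $$S^*=\lfloor x^*\rceil_{\tilde\phi(\cdot)},$$ where $x^*$ is the root of $\zeta$ in $[1,D]$, i.e. $x^*=\{x\mid \zeta(x)=0,\ x\in[1,D]\}$, and the rounding operator $\lfloor x\rceil_{\tilde\phi(\cdot)}$ equals $\lfloor x\rfloor$ if $\tilde\phi(\lfloor x\rfloor)\ge\tilde\phi(\lceil x\rceil)$ and equals $\lceil x\rceil$ otherwise. (ii) Otherwise, $S^*=\arg\max_{x\in\{1,D\}}\tilde\phi(x)$.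
   Context: The numbers $W_d$ ($1\le d\le D$) are the discriminant gains of the feature dimensions, sorted in decreasing order: $W_d=\gamma_d^2/\lambda_d$, where $\lambda_d>0$ are the eigenvalues of the class covariance matrix and $\gamma_d$ is the $d$-th coordinate, in the corresponding eigenbasis, of the difference of the centroids of the closest pair of classes. $K_a=|\mathcal{K}|$ is the number of active sensors and $\tilde\sigma^2=\frac{\sigma_{\mathrm{nor}}^2}{D K_a\lambda_{\min}\gamma_{\mathrm{sen}}}$, with $\lambda_{\min}=\min_d\lambda_d$, $\sigma_{\mathrm{nor}}^2>0$ the normalization variance and $\gamma_{\mathrm{sen}}>0$ the receive signal-to-interference ratio. Put $W_{D+1}=0$. Define $g$ on $[0,D]$ piecewise: for $d\in\{1,\dots,D\}$ and $t\in[d-1,d]$, $$g(t)=\frac{W_d-W_{d+1}}{2}\cos\bigl(\pi(t-d+1)\bigr)+\frac{W_d+W_{d+1}}{2}.$$ Define $$\psi(x)=\int_0^x g(t)\,dt,$$ a continuous approximation of $\sum_{d=1}^{S}W_d$ at $x=S$, with $\psi'(x)=g(x)$, and $$\tilde\phi(x)=\frac{K_a\,\psi(x)}{\tilde\sigma^2x+1},\qquad x\in[1,D].$$ The integer $S$ (the dimension of the feature subspace) is called the breathing depth.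
   Formalization: Uniqueness fails in general (D=2, W=(2,1), σ̃²=1/2 gives a tie). Proved: any root rounds to an optimum; otherwise any endpoint maximizer is optimal; the optimum is unique iff φ̃(S)≠φ̃(S+1) for all 1≤S<D, and then the root is unique and the formulas give S*. *)

theory Defs
  imports "HOL-Analysis.Analysis"
begin

text \<open>Gains are indexed from 1; \<open>gain D W\<close> adds the convention \<open>W (D + 1) = 0\<close>.\<close>

definition gain :: "nat \<Rightarrow> (nat \<Rightarrow> real) \<Rightarrow> nat \<Rightarrow> real" where
  "gain D W d = (if d \<le> D then W d else 0)"

text \<open>
  The piece is selected by \<open>d = \<lfloor>t\<rfloor> + 1\<close>. Neighbouring pieces agree at their common
  breakpoint, so the formula holds on every closed interval \<open>[d - 1, d]\<close>; see \<open>g_piece\<close>.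
\<close>

definition g :: "nat \<Rightarrow> (nat \<Rightarrow> real) \<Rightarrow> real \<Rightarrow> real" where
  "g D W t = (let d = nat \<lfloor>t\<rfloor> + 1 in
     (gain D W d - gain D W (d + 1)) / 2 * cos (pi * (t - real d + 1))
     + (gain D W d + gain D W (d + 1)) / 2)"

lemma g_piece:
  assumes "1 \<le> d" "d \<le> D" "real d - 1 \<le> t" "t \<le> real d"
  shows "g D W t = (gain D W d - gain D W (d + 1)) / 2 * cos (pi * (t - real d + 1))
     + (gain D W d + gain D W (d + 1)) / 2"
proof (cases "t = real d")
  case True
  then show ?thesis by (simp add: g_def Let_def field_simps)
next
  case False
  with assms have "\<lfloor>t\<rfloor> = int d - 1" by (intro floor_unique) auto
  with assms(1) have "nat \<lfloor>t\<rfloor> + 1 = d" by simp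
  then show ?thesis unfolding g_def Let_def by simp
qed

definition psi :: "nat \<Rightarrow> (nat \<Rightarrow> real) \<Rightarrow> real \<Rightarrow> real" where
  "psi D W x = integral {0..x} (g D W)"

definition phi :: "nat \<Rightarrow> (nat \<Rightarrow> real) \<Rightarrow> nat \<Rightarrow> real \<Rightarrow> real \<Rightarrow> real" where
  "phi D W Ka s2 x = real Ka * psi D W x / (s2 * x + 1)"

text \<open>
  The parameter \<open>s2\<close> is the noise level (sigma tilde squared). The derivative of \<open>psi\<close> is taken
  relative to \<open>[0, D]\<close>, hence one-sided at \<open>D\<close>.
\<close>

definition zeta :: "nat \<Rightarrow> (nat \<Rightarrow> real) \<Rightarrow> real \<Rightarrow> real \<Rightarrow> real" where
  "zeta D W s2 x =
     vector_derivative (psi D W) (at x within {0..real D}) * (s2 * x + 1) - s2 * psi D W x"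

definition optimal_depth ::
    "nat \<Rightarrow> (nat \<Rightarrow> real) \<Rightarrow> nat \<Rightarrow> real \<Rightarrow> int \<Rightarrow> bool" where
  "optimal_depth D W Ka s2 S \<longleftrightarrow>
     is_arg_max (\<lambda>S. phi D W Ka s2 (real_of_int S)) (\<lambda>S. S \<in> {1..int D}) S"

definition round_by :: "(real \<Rightarrow> real) \<Rightarrow> real \<Rightarrow> int" where
  "round_by f x = (if f (real_of_int \<lfloor>x\<rfloor>) \<ge> f (real_of_int \<lceil>x\<rceil>) then \<lfloor>x\<rfloor> else \<lceil>x\<rceil>)"

lemma g_piece_has_integral:
  assumes "1 \<le> d" "d \<le> D"
  shows "(g D W has_integral (gain D W d + gain D W (d + 1)) / 2) {real d - 1..real d}"
proof -
  define a b where "a = (gain D W d - gain D W (d + 1)) / 2"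
    and "b = (gain D W d + gain D W (d + 1)) / 2"
  define F where "F t = a * sin (pi * (t - real d + 1)) / pi + b * t" for t
  have "((\<lambda>t. a * cos (pi * (t - real d + 1)) + b) has_integral (F (real d) - F (real d - 1)))
      {real d - 1..real d}"
    by (rule fundamental_theorem_of_calculus)
      (auto simp: F_def has_real_derivative_iff_has_vector_derivative[symmetric]
        intro!: derivative_eq_intros)
  moreover have "F (real d) - F (real d - 1) = b" by (simp add: F_def algebra_simps)
  ultimately have "((\<lambda>t. a * cos (pi * (t - real d + 1)) + b) has_integral b)
      {real d - 1..real d}" by simp
  then show ?thesis unfolding a_def b_def
    by (rule has_integral_eq[rotated]) (use assms in \<open>auto simp: g_piece\<close>)
qed

lemma g_has_integral:
  assumes "n \<le> D"
  shows "(g D W has_integral (\<Sum>d=1..n. (gain D W d + gain D W (d + 1)) / 2)) {0..real n}"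
  using assms
proof (induction n)
  case (Suc n)
  have "(g D W has_integral (\<Sum>d=1..n. (gain D W d + gain D W (d + 1)) / 2)
      + (gain D W (Suc n) + gain D W (Suc n + 1)) / 2) {0..real (Suc n)}"
    using Suc g_piece_has_integral[of "Suc n" D W]
    by (intro has_integral_combine[of 0 "real n"]) auto
  then show ?case by simp
qed auto

lemma psi_nat:
  "n \<le> D \<Longrightarrow> psi D W (real n) = (\<Sum>d=1..n. (gain D W d + gain D W (d + 1)) / 2)"
  unfolding psi_def by (rule integral_unique[OF g_has_integral])

text \<open>
  Optimal depths need not be unique, even for strictly decreasing positive gains: with
  \<open>W 1 = 2\<close>, \<open>W 2 = 1\<close> and noise level \<open>1/2\<close>, the depths 1 and 2 tie.
\<close>

lemma optimal_depth_tie: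
  fixes W :: "nat \<Rightarrow> real"
  assumes "W 1 = 2" "W 2 = 1"
  shows "optimal_depth 2 W Ka (1/2) 1" "optimal_depth 2 W Ka (1/2) 2"
proof -
  have "psi 2 W 1 = 3/2" "psi 2 W 2 = 2"
    using psi_nat[of 1 2 W] psi_nat[of 2 2 W] assms by (auto simp: gain_def numeral_2_eq_2)
  then have *: "phi 2 W Ka (1/2) 1 = Ka" "phi 2 W Ka (1/2) 2 = Ka"
    by (auto simp: phi_def)
  have "S \<in> {1..2} \<longleftrightarrow> S = 1 \<or> S = 2" for S :: int by auto
  with * show "optimal_depth 2 W Ka (1/2) 1" "optimal_depth 2 W Ka (1/2) 2"
    by (auto simp: optimal_depth_def is_arg_max_def)
qed

end

theory Submission
  imports Defs
begin

text \<open>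
  Since \<open>g\<close> is decreasing, \<open>zeta\<close> is decreasing, and it carries the sign of the derivative of
  \<open>phi\<close>. Hence every root of \<open>zeta\<close> is a peak of \<open>phi\<close>: \<open>phi\<close> increases before it and decreases
  after it, so a best integer is next to the root. By Rolle's theorem, two distinct integers with
  equal values of \<open>phi\<close> enclose such a peak, which identifies multiple optima with ties between
  neighbours. Two distinct roots force a piece of \<open>g\<close> to be constant, and with it \<open>phi\<close> to be
  constant between two neighbouring integers.
\<close>

lemma finite_is_arg_max_ex:
  fixes f :: "'a \<Rightarrow> 'b::linorder"
  assumes "finite A" "A \<noteq> {}"
  shows "\<exists>x. is_arg_max f (\<lambda>x. x \<in> A) x"
proof -
  have "Max (f ` A) \<in> f ` A" using assms by simp
  then obtain x where "x \<in> A" "f x = Max (f ` A)" by auto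
  with assms(1) show ?thesis
    by (auto simp: is_arg_max_linorder intro!: exI[of _ x])
qed

locale sorted_gains =
  fixes D Ka :: nat and W :: "nat \<Rightarrow> real" and s2 :: real
  assumes D_pos: "1 \<le> D"
    and W_decreasing: "\<And>d. 1 \<le> d \<Longrightarrow> d < D \<Longrightarrow> W (d + 1) \<le> W d"
    and W_nonneg: "0 \<le> W D"
    and Ka_pos: "1 \<le> Ka"
    and s2_pos: "0 < s2"
begin

section \<open>Monotonicity and continuity of \<open>g\<close>\<close>

lemma gain_Suc_le: "1 \<le> d \<Longrightarrow> gain D W (Suc d) \<le> gain D W d"
  \<comment> \<open>At \<open>d = D\<close> the next gain is 0 by convention, so
    \<open>W_nonneg\<close> takes over; beyond \<open>D\<close> both gains are 0.\<close>
  using W_decreasing[of d] W_nonneg by (cases "d = D") (auto simp: gain_def)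

lemma gain_antimono:
  assumes "1 \<le> d" "d \<le> e"
  shows "gain D W e \<le> gain D W d"
  using assms(2,1)
proof (induction e rule: dec_induct)
  case (step n)
  then show ?case using gain_Suc_le[of n] by simp
qed simp

text \<open>On its piece \<open>g\<close> is the mean of two neighbouring gains with weights
  \<open>(1 + c) / 2\<close> and \<open>(1 - c) / 2\<close>, where \<open>c\<close> is the cosine.
  These bounds allow values from different pieces to be compared.\<close>

lemma g_bounds:
  fixes t :: real
  assumes "0 \<le> t"
  defines "d \<equiv> nat \<lfloor>t\<rfloor> + 1"
  shows "gain D W (d + 1) \<le> g D W t" "g D W t \<le> gain D W d"
proof -
  define a b c where "a = gain D W d" and "b = gain D W (d + 1)"
    and "c = cos (pi * (t - real d + 1))"
  have g: "g D W t = (a - b) / 2 * c + (a + b) / 2"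
    by (simp add: g_def Let_def d_def a_def b_def c_def)
  have ab: "0 \<le> a - b" using gain_Suc_le[of d] by (simp add: d_def a_def b_def)
  have "(a - b) * (-1) \<le> (a - b) * c" "(a - b) * c \<le> (a - b) * 1"
    using ab by (intro mult_left_mono; simp add: c_def)+
  then have "b \<le> g D W t" "g D W t \<le> a" by (auto simp: g field_simps)
  then show "gain D W (d + 1) \<le> g D W t" "g D W t \<le> gain D W d" by (simp_all add: a_def b_def)
qed

text \<open>Within one piece the cosine runs over \<open>[0, pi]\<close>, where it decreases. Across
  pieces, the upper bound at \<open>y\<close> is a gain that comes no earlier than the lower bound
  at \<open>x\<close>.\<close>

lemma g_antimono:
  assumes "0 \<le> x" "x \<le> y"
  shows "g D W y \<le> g D W x"
proof (cases "\<lfloor>x\<rfloor> = \<lfloor>y\<rfloor>")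
  case True
  define d where "d = nat \<lfloor>x\<rfloor> + 1"
  have d: "real d = of_int \<lfloor>x\<rfloor> + 1" using assms by (simp add: d_def)
  have "y - real d + 1 \<le> 1" using d True by linarith
  then have "pi * (y - real d + 1) \<le> pi * 1" by (intro mult_left_mono) auto
  moreover have "0 \<le> x - real d + 1" using d by linarith
  moreover have "pi * (x - real d + 1) \<le> pi * (y - real d + 1)"
    using assms by (intro mult_left_mono) auto
  ultimately have "cos (pi * (y - real d + 1)) \<le> cos (pi * (x - real d + 1))"
    by (intro cos_monotone_0_pi_le) auto
  moreover have "0 \<le> (gain D W d - gain D W (d + 1)) / 2"
    using gain_Suc_le[of d] by (simp add: d_def)
  ultimately have "(gain D W d - gain D W (d + 1)) / 2 * cos (pi * (y - real d + 1))
      \<le> (gain D W d - gain D W (d + 1)) / 2 * cos (pi * (x - real d + 1))"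
    by (rule mult_left_mono)
  then show ?thesis using True by (simp add: g_def Let_def d_def)
next
  case False
  have "\<lfloor>x\<rfloor> \<le> \<lfloor>y\<rfloor>" using assms by (intro floor_mono)
  then have "nat \<lfloor>x\<rfloor> + 1 + 1 \<le> nat \<lfloor>y\<rfloor> + 1" using False assms by linarith
  then have "gain D W (nat \<lfloor>y\<rfloor> + 1) \<le> gain D W (nat \<lfloor>x\<rfloor> + 1 + 1)"
    by (intro gain_antimono) auto
  then show ?thesis using g_bounds(1)[of x] g_bounds(2)[of y] assms by simp
qed

lemma continuous_on_g: "n \<le> D \<Longrightarrow> continuous_on {0..real n} (g D W)"
proof (induction n)
  case (Suc n)
  have piece: "continuous_on {real n..real (Suc n)} (g D W)"
    by (rule continuous_on_eq[where f = "\<lambda>t. (gain D W (Suc n) - gain D W (Suc n + 1)) / 2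
          * cos (pi * (t - real (Suc n) + 1)) + (gain D W (Suc n) + gain D W (Suc n + 1)) / 2"])
      (use Suc.prems in \<open>auto intro!: continuous_intros simp: g_piece[of "Suc n"]\<close>)
  have "{0..real (Suc n)} = {0..real n} \<union> {real n..real (Suc n)}" by auto
  then show ?case using piece Suc by (auto intro!: continuous_on_closed_Un)
qed simp

section \<open>Derivatives of \<open>psi\<close> and \<open>phi\<close> and their mean value
  forms\<close>

lemma psi_deriv:
  assumes "x \<in> {0..real D}"
  shows "(psi D W has_vector_derivative g D W x) (at x within {0..real D})"
  using integral_has_vector_derivative[OF continuous_on_g[OF order_refl] assms]
  by (simp add: psi_def[abs_def])

lemma zeta_eq:
  assumes "x \<in> {0..real D}"
  shows "zeta D W s2 x = g D W x * (s2 * x + 1) - s2 * psi D W x"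
  \<comment> \<open>\<open>D_pos\<close> makes the interval nondegenerate, so the one-sided
    derivatives at its ends are determined as well.\<close>
  using vector_derivative_within_closed_interval[OF _ assms psi_deriv[OF assms]] D_pos
  by (simp add: zeta_def)

lemma noise_pos: "0 \<le> x \<Longrightarrow> 0 < s2 * x + 1"
  using s2_pos by (simp add: add_nonneg_pos)

lemma continuous_on_psi: "continuous_on {0..real D} (psi D W)"
  using psi_deriv by (rule continuous_on_vector_derivative)

lemma continuous_on_zeta: "continuous_on {0..real D} (zeta D W s2)"
  by (rule continuous_on_eq[where f = "\<lambda>x. g D W x * (s2 * x + 1) - s2 * psi D W x"])
    (auto intro!: continuous_intros continuous_on_g continuous_on_psi simp: zeta_eq)

lemma phi_deriv:
  assumes "x \<in> {0..real D}"
  shows "(phi D W Ka s2 has_real_derivative Ka * zeta D W s2 x / (s2 * x + 1)\<^sup>2)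
    (at x within {0..real D})"
proof -
  have psi: "(psi D W has_real_derivative g D W x) (at x within {0..real D})"
    using psi_deriv[OF assms] by (simp add: has_real_derivative_iff_has_vector_derivative)
  have "s2 * x + 1 \<noteq> 0" using noise_pos[of x] assms by simp
  then show ?thesis unfolding phi_def[abs_def]
    by (auto intro!: derivative_eq_intros psi simp: zeta_eq[OF assms] power2_eq_square algebra_simps)
qed

lemma psi_mvt:
  assumes "0 \<le> a" "a < b" "b \<le> real D"
  shows "\<exists>t. a < t \<and> t < b \<and> psi D W b - psi D W a = (b - a) * g D W t"
proof -
  have "\<exists>t\<in>{a<..<b}. psi D W b - psi D W a = (\<lambda>h. h * g D W t) (b - a)"
  proof (rule mvt_simple[OF assms(2)])
    fix x assume "a \<le> x" "x \<le> b"
    then have "(psi D W has_vector_derivative g D W x) (at x within {a..b})"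
      using assms by (intro has_vector_derivative_within_subset[OF psi_deriv]) auto
    then show "(psi D W has_derivative (\<lambda>h. h * g D W x)) (at x within {a..b})"
      by (simp add: has_vector_derivative_def)
  qed
  then show ?thesis by auto
qed

text \<open>The derivative is split so that the factor after \<open>zeta\<close> is positive: the
  increment of \<open>phi\<close> has the sign of \<open>zeta\<close> at an interior point.\<close>

lemma phi_mvt:
  assumes "0 \<le> a" "a < b" "b \<le> real D"
  shows "\<exists>t. a < t \<and> t < b \<and>
    phi D W Ka s2 b - phi D W Ka s2 a = zeta D W s2 t * ((b - a) * Ka / (s2 * t + 1)\<^sup>2)"
proof -
  define p where "p x = Ka * zeta D W s2 x / (s2 * x + 1)\<^sup>2" for x
  have "\<exists>t\<in>{a<..<b}. phi D W Ka s2 b - phi D W Ka s2 a = (*) (p t) (b - a)"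
  proof (rule mvt_simple[OF assms(2)])
    fix x assume "a \<le> x" "x \<le> b"
    then have "(phi D W Ka s2 has_real_derivative p x) (at x within {a..b})"
      unfolding p_def using assms by (intro DERIV_subset[OF phi_deriv]) auto
    then show "(phi D W Ka s2 has_derivative (*) (p x)) (at x within {a..b})"
      by (simp add: has_field_derivative_def)
  qed
  then show ?thesis by (auto simp: p_def mult_ac)
qed

section \<open>Monotonicity of \<open>zeta\<close> and the resulting shape of
  \<open>phi\<close>\<close>

lemma zeta_diff_ge:
  assumes "0 \<le> x" "x \<le> y" "y \<le> real D"
  shows "(g D W x - g D W y) * (s2 * x + 1) \<le> zeta D W s2 x - zeta D W s2 y"
proof (cases "x = y")
  case False
  then obtain t where t: "x < t" "t < y" "psi D W y - psi D W x = (y - x) * g D W t"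
    using psi_mvt[of x y] assms by auto
  have "(y - x) * g D W y \<le> psi D W y - psi D W x"
    unfolding t(3) using t assms by (intro mult_left_mono g_antimono) auto
  then have "s2 * ((y - x) * g D W y) \<le> s2 * (psi D W y - psi D W x)"
    using s2_pos by (intro mult_left_mono) auto
  \<comment> \<open>The right side exceeds the left by
    \<open>s2 * (psi D W y - psi D W x - (y - x) * g D W y)\<close>, which has just been shown
    nonnegative. No derivative of \<open>zeta\<close> enters.\<close>
  then show ?thesis using assms by (simp add: zeta_eq algebra_simps)
qed simp

lemma zeta_antimono:
  assumes "0 \<le> x" "x \<le> y" "y \<le> real D"
  shows "zeta D W s2 y \<le> zeta D W s2 x"
proof -
  have "0 \<le> (g D W x - g D W y) * (s2 * x + 1)"
    using g_antimono[of x y] noise_pos[of x] assms by simp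
  then show ?thesis using zeta_diff_ge[OF assms] by simp
qed

text \<open>Since \<open>zeta\<close> decreases, its sign at the right end \<open>b\<close> settles
  its sign on all of \<open>[a, b]\<close>.\<close>

lemma phi_increasing:
  assumes "0 \<le> a" "a \<le> b" "b \<le> real D" "0 \<le> zeta D W s2 b"
  shows "phi D W Ka s2 a \<le> phi D W Ka s2 b"
proof (cases "a = b")
  case False
  then obtain t where t: "a < t" "t < b"
    "phi D W Ka s2 b - phi D W Ka s2 a = zeta D W s2 t * ((b - a) * Ka / (s2 * t + 1)\<^sup>2)"
    using phi_mvt[of a b] assms by auto
  have "0 \<le> zeta D W s2 t" using zeta_antimono[of t b] t assms by simp
  then have "0 \<le> phi D W Ka s2 b - phi D W Ka s2 a"
    unfolding t(3) using assms by (intro mult_nonneg_nonneg divide_nonneg_nonneg) auto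
  then show ?thesis by simp
qed simp

lemma phi_decreasing:
  assumes "0 \<le> a" "a \<le> b" "b \<le> real D" "zeta D W s2 a \<le> 0"
  shows "phi D W Ka s2 b \<le> phi D W Ka s2 a"
proof (cases "a = b")
  case False
  then obtain t where t: "a < t" "t < b"
    "phi D W Ka s2 b - phi D W Ka s2 a = zeta D W s2 t * ((b - a) * Ka / (s2 * t + 1)\<^sup>2)"
    using phi_mvt[of a b] assms by auto
  have "zeta D W s2 t \<le> 0" using zeta_antimono[of a t] t assms by simp
  then have "phi D W Ka s2 b - phi D W Ka s2 a \<le> 0"
    unfolding t(3) using assms by (intro mult_nonpos_nonneg divide_nonneg_nonneg) auto
  then show ?thesis by simp
qed simp

lemma rolle_root:
  assumes "0 \<le> a" "a < b" "b \<le> real D" "phi D W Ka s2 a = phi D W Ka s2 b"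
  shows "\<exists>t. a < t \<and> t < b \<and> zeta D W s2 t = 0"
proof -
  obtain t where t: "a < t" "t < b"
    "phi D W Ka s2 b - phi D W Ka s2 a = zeta D W s2 t * ((b - a) * Ka / (s2 * t + 1)\<^sup>2)"
    using phi_mvt[of a b] assms by auto
  have "0 < (b - a) * Ka / (s2 * t + 1)\<^sup>2"
    using noise_pos[of t] t assms Ka_pos by (auto intro!: divide_pos_pos mult_pos_pos)
  then show ?thesis using t assms(4) by auto
qed

section \<open>Optimality of the rounded root and of the endpoints\<close>

definition best_depth :: "int \<Rightarrow> bool" where
  "best_depth = optimal_depth D W Ka s2"

lemma best_depth_iff:
  "best_depth S \<longleftrightarrow> S \<in> {1..int D} \<and> (\<forall>T\<in>{1..int D}. phi D W Ka s2 T \<le> phi D W Ka s2 S)"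
  by (auto simp: best_depth_def optimal_depth_def is_arg_max_linorder)

lemma best_depth_ex: "\<exists>S. best_depth S"
  unfolding best_depth_def optimal_depth_def using D_pos by (intro finite_is_arg_max_ex) auto

lemma real_le_D: "T \<le> int D \<Longrightarrow> real_of_int T \<le> real D"
  by linarith

text \<open>Every integer is at most the floor of the root, on the increasing side, or at least its
  ceiling, on the decreasing side; \<open>round_by\<close> takes the better of the two. This covers
  every root, also when there are several.\<close>

lemma round_root_best:
  assumes x: "x \<in> {1..real D}" "zeta D W s2 x = 0"
  shows "best_depth (round_by (phi D W Ka s2) x)"
proof -
  have range: "1 \<le> \<lfloor>x\<rfloor>" "\<lceil>x\<rceil> \<le> int D" using x by (auto simp: ceiling_le_iff)
  then have mem: "\<lfloor>x\<rfloor> \<in> {1..int D}" "\<lceil>x\<rceil> \<in> {1..int D}"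
    using floor_le_ceiling[of x] unfolding atLeastAtMost_iff by linarith+
  have "phi D W Ka s2 T \<le> max (phi D W Ka s2 \<lfloor>x\<rfloor>) (phi D W Ka s2 \<lceil>x\<rceil>)"
    if T: "T \<in> {1..int D}" for T
  proof (cases "T \<le> \<lfloor>x\<rfloor>")
    case True
    have "0 \<le> zeta D W s2 \<lfloor>x\<rfloor>" using zeta_antimono[of "\<lfloor>x\<rfloor>" x] x range by simp
    then have "phi D W Ka s2 T \<le> phi D W Ka s2 \<lfloor>x\<rfloor>"
      using True T mem real_le_D by (intro phi_increasing) auto
    then show ?thesis by simp
  next
    case False
    then have T': "\<lceil>x\<rceil> \<le> T" by linarith
    have "zeta D W s2 \<lceil>x\<rceil> \<le> 0" using zeta_antimono[of x "\<lceil>x\<rceil>"] x real_le_D range by simp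
    then have "phi D W Ka s2 T \<le> phi D W Ka s2 \<lceil>x\<rceil>"
      using T' T mem real_le_D by (intro phi_decreasing) auto
    then show ?thesis by simp
  qed
  then show ?thesis using mem by (cases "phi D W Ka s2 \<lceil>x\<rceil> \<le> phi D W Ka s2 \<lfloor>x\<rfloor>")
      (simp_all add: best_depth_iff round_by_def)
qed

text \<open>A decreasing \<open>zeta\<close> without strict sign change is nonnegative up to
  \<open>D\<close> or nonpositive from 1 on, so \<open>phi\<close> is monotone on
  \<open>[1, D]\<close>.\<close>

lemma endpoint_best:
  assumes sign: "\<not> zeta D W s2 1 * zeta D W s2 (real D) < 0"
    and S: "is_arg_max (\<lambda>S. phi D W Ka s2 (real_of_int S)) (\<lambda>S. S \<in> {1, int D}) S"
  shows "best_depth S"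
proof -
  have S': "S \<in> {1, int D}" "phi D W Ka s2 1 \<le> phi D W Ka s2 S"
    "phi D W Ka s2 (real D) \<le> phi D W Ka s2 S"
    using S by (auto simp: is_arg_max_linorder)
  have "zeta D W s2 (real D) \<le> zeta D W s2 1" using zeta_antimono[of 1 D] D_pos by simp
  then consider "0 \<le> zeta D W s2 (real D)" | "zeta D W s2 1 \<le> 0"
    using sign by (auto simp: mult_less_0_iff)
  then have "phi D W Ka s2 T \<le> phi D W Ka s2 S" if T: "T \<in> {1..int D}" for T
  proof cases
    case 1
    then have "phi D W Ka s2 T \<le> phi D W Ka s2 (real D)"
      using T real_le_D by (intro phi_increasing) auto
    then show ?thesis using S' by simp
  next
    case 2
    then have "phi D W Ka s2 T \<le> phi D W Ka s2 1"
      using T real_le_D by (intro phi_decreasing) auto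
    then show ?thesis using S' by simp
  qed
  then show ?thesis using S' D_pos by (auto simp: best_depth_iff)
qed

lemma root_ex:
  assumes "zeta D W s2 1 * zeta D W s2 (real D) < 0"
  shows "\<exists>x\<in>{1..real D}. zeta D W s2 x = 0"
proof -
  have "zeta D W s2 (real D) \<le> zeta D W s2 1" using zeta_antimono[of 1 D] D_pos by simp
  then have "zeta D W s2 (real D) \<le> 0" "0 \<le> zeta D W s2 1"
    using assms by (auto simp: mult_less_0_iff)
  moreover have "continuous_on {1..real D} (zeta D W s2)"
    by (rule continuous_on_subset[OF continuous_on_zeta]) auto
  ultimately show ?thesis using IVT2'[of "zeta D W s2" D 0 1] D_pos by auto
qed

section \<open>Ties between neighbouring depths, and uniqueness of the optimum and of the
  root\<close>

definition tie_free :: bool where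
  "tie_free \<longleftrightarrow>
    (\<forall>S\<in>{1..<int D}. phi D W Ka s2 (real_of_int S) \<noteq> phi D W Ka s2 (real_of_int (S + 1)))"

text \<open>A tie cannot occur below the maximum: Rolle puts a root strictly between the two
  neighbours, and these are then its floor and ceiling.\<close>

lemma tie_best:
  assumes S: "S \<in> {1..<int D}" and tie: "phi D W Ka s2 S = phi D W Ka s2 (S + 1)"
  shows "best_depth S" "best_depth (S + 1)"
proof -
  obtain z :: real where z: "S < z" "z < S + 1" "zeta D W s2 z = 0"
    using rolle_root[of S "S + 1"] tie S by auto
  have "z \<in> {1..real D}" using z S by auto
  then have best: "best_depth (round_by (phi D W Ka s2) z)" using z by (intro round_root_best)
  have "\<lfloor>z\<rfloor> = S" using z by (intro floor_unique) auto
  moreover have "\<lceil>z\<rceil> = S + 1" using z by (intro ceiling_unique) auto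
  \<comment> \<open>\<open>round_by\<close> resolves ties in favour of the floor;
    \<open>S + 1\<close> is then optimal because it has the same value.\<close>
  ultimately have "round_by (phi D W Ka s2) z = S" using tie by (simp add: round_by_def)
  with best show "best_depth S" by simp
  with tie S show "best_depth (S + 1)" by (simp add: best_depth_iff)
qed

text \<open>Let \<open>z\<close> be a peak between the two optima. If \<open>S + 1\<close> lies
  before \<open>z\<close>, \<open>phi\<close> does not fall from \<open>S\<close> to it; otherwise
  \<open>phi\<close> does not rise from it to \<open>T\<close>. Either way \<open>S + 1\<close>
  reaches the optimal value and ties with \<open>S\<close>.\<close>

lemma two_best_tie:
  assumes "best_depth S" "best_depth T" "S < T"
  shows "\<not> tie_free"
proof -
  have S: "S \<in> {1..int D}" "T \<in> {1..int D}" and eq: "phi D W Ka s2 S = phi D W Ka s2 T"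
    using assms by (auto simp: best_depth_iff intro!: antisym)
  obtain z :: real where z: "S < z" "z < T" "zeta D W s2 z = 0"
    using rolle_root[of S T] eq S assms real_le_D by auto
  have S1: "S + 1 \<in> {1..int D}" using S assms by auto
  have "phi D W Ka s2 S \<le> phi D W Ka s2 (S + 1)"
  proof (cases "S + 1 \<le> z")
    case True
    then have "0 \<le> zeta D W s2 (S + 1)"
      using zeta_antimono[of "S + 1" z] z S real_le_D[of T] by auto
    then show ?thesis using S1 S real_le_D[of "S + 1"] by (intro phi_increasing) auto
  next
    case False
    have "real_of_int (S + 1) \<le> real_of_int T" using assms(3) by (simp only: of_int_le_iff)
    moreover from this False have "zeta D W s2 (S + 1) \<le> 0"
      using zeta_antimono[of z "S + 1"] z S real_le_D[of T] by auto
    ultimately have "phi D W Ka s2 T \<le> phi D W Ka s2 (S + 1)"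
      using S real_le_D[of T] by (intro phi_decreasing) auto
    then show ?thesis using eq by simp
  qed
  moreover have "phi D W Ka s2 (real_of_int (S + 1)) \<le> phi D W Ka s2 S"
    using assms(1) S1 by (simp only: best_depth_iff)
  ultimately have "phi D W Ka s2 S = phi D W Ka s2 (real_of_int (S + 1))" by simp
  moreover have "S \<in> {1..<int D}" using S S1 by auto
  ultimately show ?thesis by (auto simp: tie_free_def)
qed

lemma ex1_best_iff: "(\<exists>!S. best_depth S) \<longleftrightarrow> tie_free"
proof
  assume "\<exists>!S. best_depth S"
  then have unique: "best_depth S \<Longrightarrow> best_depth T \<Longrightarrow> S = T" for S T by auto
  show tie_free unfolding tie_free_def
  proof (intro ballI notI)
    fix S assume "S \<in> {1..<int D}" "phi D W Ka s2 (of_int S) = phi D W Ka s2 (of_int (S + 1))"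
    then show False using unique[of S "S + 1"] tie_best[of S] by simp
  qed
next
  assume tie_free
  then have "S = T" if "best_depth S" "best_depth T" for S T
    using two_best_tie[of S T] two_best_tie[of T S] that by (cases S T rule: linorder_cases) auto
  then show "\<exists>!S. best_depth S" using best_depth_ex by blast
qed

text \<open>Between two roots \<open>zeta\<close> vanishes, so \<open>g\<close> cannot drop there.
  The strict decrease of the cosine then leaves only equal gains on the piece containing
  \<open>x\<close>, and \<open>phi\<close> is constant on that whole piece.\<close>

lemma two_roots_tie:
  assumes "1 \<le> x" "x < y" "y \<le> real D" and roots: "zeta D W s2 x = 0" "zeta D W s2 y = 0"
  shows "\<not> tie_free"
proof -
  define d where "d = nat \<lfloor>x\<rfloor> + 1"
  \<comment> \<open>Cutting \<open>y\<close> at the right end of the piece of \<open>x\<close> puts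
    both points under one cosine formula; \<open>y'\<close> is still a root, by
    monotonicity.\<close>
  define y' where "y' = min y (real d)"
  have d: "real d = of_int \<lfloor>x\<rfloor> + 1" using assms by (simp add: d_def)
  have x: "real d - 1 \<le> x" "x < real d" using d by linarith+
  have "real d < real (D + 1)" using x assms by simp
  moreover have "1 < real d" using x assms by linarith
  \<comment> \<open>From \<open>1 \<le> x\<close> comes \<open>2 \<le> d\<close>, which makes
    \<open>d - 1\<close> an admissible depth for the tie.\<close>
  ultimately have dD: "2 \<le> d" "d \<le> D" by auto
  have y': "x < y'" "y' \<le> y" "y' \<le> real d" using x assms by (auto simp: y'_def)
  have "zeta D W s2 y' = 0"
    using zeta_antimono[of x y'] zeta_antimono[of y' y] y' assms by simp
  then have "(g D W x - g D W y') * (s2 * x + 1) \<le> 0"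
    using zeta_diff_ge[of x y'] y' assms by simp
  then have "g D W x \<le> g D W y'" using noise_pos[of x] assms by (simp add: mult_le_0_iff)
  then have "(gain D W d - gain D W (d + 1)) / 2 * cos (pi * (x - real d + 1))
      \<le> (gain D W d - gain D W (d + 1)) / 2 * cos (pi * (y' - real d + 1))"
    using g_piece[of d D x W] g_piece[of d D y' W] x y' dD by simp
  moreover have "cos (pi * (y' - real d + 1)) < cos (pi * (x - real d + 1))"
  proof (rule cos_monotone_0_pi)
    have "pi * (y' - real d + 1) \<le> pi * 1" using y' by (intro mult_left_mono) auto
    then show "pi * (y' - real d + 1) \<le> pi" by simp
  qed (use x y' in auto)
  \<comment> \<open>A positive difference of gains would turn the strict cosine inequality into a
    strict drop of \<open>g\<close>.\<close>
  ultimately have "gain D W d \<le> gain D W (d + 1)"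
    by (auto simp: mult_le_cancel_left)
  then have flat: "gain D W (d + 1) = gain D W d"
    using gain_Suc_le[of d] dD by simp
  have g_flat: "g D W t = gain D W d" if "real d - 1 \<le> t" "t \<le> real d" for t
    using g_piece[of d D t W] that dD flat by simp
  obtain t where "psi D W (real d) - psi D W (real d - 1) = g D W t" "real d - 1 < t" "t < real d"
    using psi_mvt[of "real d - 1" "real d"] dD by auto
  then have psi: "psi D W (real d) = psi D W (real d - 1) + gain D W d"
    using g_flat[of t] by simp
  \<comment> \<open>Where \<open>g\<close> is constant, \<open>psi\<close> is affine and the growth
    of the two terms of \<open>zeta\<close> cancels. Its common end value must be 0, since
    \<open>x\<close> is a root in the piece.\<close>
  have "zeta D W s2 (real d - 1) = zeta D W s2 (real d)"
    using dD by (simp add: zeta_eq g_flat psi algebra_simps)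
  then have root: "zeta D W s2 t = 0" if "real d - 1 < t" "t < real d" for t
    using zeta_antimono[of "real d - 1" t] zeta_antimono[of t "real d"]
      zeta_antimono[of "real d - 1" x] zeta_antimono[of x "real d"] that x dD roots by simp
  obtain t where "real d - 1 < t" "t < real d" "phi D W Ka s2 d - phi D W Ka s2 (real d - 1)
      = zeta D W s2 t * ((real d - (real d - 1)) * Ka / (s2 * t + 1)\<^sup>2)"
    using phi_mvt[of "real d - 1" "real d"] dD by auto
  with root[of t] have "phi D W Ka s2 (real_of_int (int d - 1))
      = phi D W Ka s2 (real_of_int (int d - 1 + 1))"
    by simp
  moreover have "int d - 1 \<in> {1..<int D}" using dD by auto
  ultimately show ?thesis unfolding tie_free_def by blast
qed

lemma tie_free_root_unique:
  assumes "tie_free" "x \<in> {1..real D}" "zeta D W s2 x = 0" "y \<in> {1..real D}" "zeta D W s2 y = 0"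
  shows "x = y"
  using two_roots_tie[of x y] two_roots_tie[of y x] assms by (cases x y rule: linorder_cases) auto

end

text \<open>Ties as in \<open>optimal_depth_tie\<close> rule out unconditional uniqueness. So the
  two cases are first stated for every root and every endpoint maximizer, then uniqueness is
  characterized by the absence of neighbouring ties, and under that condition the root and the
  formulas for the optimum become unique.\<close>

theorem proposition2:
  fixes D Ka :: nat and W :: "nat \<Rightarrow> real" and s2 :: real
  assumes "1 \<le> D"
    and "\<And>d. 1 \<le> d \<Longrightarrow> d < D \<Longrightarrow> W (d + 1) \<le> W d"
    and "0 \<le> W D"
    and "1 \<le> Ka"
    and "0 < s2"
  shows
    "(zeta D W s2 1 * zeta D W s2 (real D) < 0 \<longrightarrow>
        (\<exists>x\<in>{1..real D}. zeta D W s2 x = 0) \<and>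
        (\<forall>x\<in>{1..real D}. zeta D W s2 x = 0 \<longrightarrow>
          optimal_depth D W Ka s2 (round_by (phi D W Ka s2) x)))
   \<and> (\<not> zeta D W s2 1 * zeta D W s2 (real D) < 0 \<longrightarrow>
        (\<forall>S. is_arg_max (\<lambda>S. phi D W Ka s2 (real_of_int S)) (\<lambda>S. S \<in> {1, int D}) S \<longrightarrow>
          optimal_depth D W Ka s2 S))
   \<and> ((\<exists>!S. optimal_depth D W Ka s2 S) \<longleftrightarrow>
        (\<forall>S\<in>{1..<int D}. phi D W Ka s2 (real_of_int S) \<noteq> phi D W Ka s2 (real_of_int (S + 1))))
   \<and> ((\<forall>S\<in>{1..<int D}. phi D W Ka s2 (real_of_int S) \<noteq> phi D W Ka s2 (real_of_int (S + 1))) \<longrightarrow>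
        (\<exists>!S. optimal_depth D W Ka s2 S) \<and>
        (\<forall>S. optimal_depth D W Ka s2 S \<longrightarrow>
          (zeta D W s2 1 * zeta D W s2 (real D) < 0 \<longrightarrow>
            (\<exists>!x. x \<in> {1..real D} \<and> zeta D W s2 x = 0) \<and>
            S = round_by (phi D W Ka s2) (THE x. x \<in> {1..real D} \<and> zeta D W s2 x = 0)) \<and>
          (\<not> zeta D W s2 1 * zeta D W s2 (real D) < 0 \<longrightarrow>
            (\<forall>S'. is_arg_max (\<lambda>S. phi D W Ka s2 (real_of_int S)) (\<lambda>S. S \<in> {1, int D}) S'
              \<longleftrightarrow> S' = S))))"
proof -
  interpret sorted_gains D Ka W s2 using assms by unfold_locales auto
  let ?sign = "zeta D W s2 1 * zeta D W s2 (real D) < 0"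
  let ?endpoint = "is_arg_max (\<lambda>S. phi D W Ka s2 (real_of_int S)) (\<lambda>S. S \<in> {1, int D})"
  have root_case: "S = round_by (phi D W Ka s2) (THE x. x \<in> {1..real D} \<and> zeta D W s2 x = 0)
      \<and> (\<exists>!x. x \<in> {1..real D} \<and> zeta D W s2 x = 0)"
    if "tie_free" "best_depth S" "?sign" for S
  proof -
    have root: "\<exists>!x. x \<in> {1..real D} \<and> zeta D W s2 x = 0"
      using root_ex[OF \<open>?sign\<close>] tie_free_root_unique[OF \<open>tie_free\<close>] by blast
    from round_root_best theI'[OF this]
    have "best_depth (round_by (phi D W Ka s2) (THE x. x \<in> {1..real D} \<and> zeta D W s2 x = 0))"
      by blast
    with root that ex1_best_iff show ?thesis by blast
  qed
  \<comment> \<open>Existence gives the direction from \<open>S' = S\<close>: some endpoint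
    maximizer exists, is optimal by \<open>endpoint_best\<close>, and hence equals
    \<open>S\<close>.\<close>
  have "\<exists>S. ?endpoint S" by (intro finite_is_arg_max_ex) auto
  then have endpoint_case: "?endpoint S' \<longleftrightarrow> S' = S"
    if "tie_free" "best_depth S" "\<not> ?sign" for S S'
    using endpoint_best[OF \<open>\<not> ?sign\<close>] that ex1_best_iff by blast
  show ?thesis
    unfolding best_depth_def[symmetric] tie_free_def[symmetric]
  proof (intro conjI impI allI ballI)
    show "\<exists>x\<in>{1..real D}. zeta D W s2 x = 0" if ?sign using root_ex[OF that] .
    show "best_depth (round_by (phi D W Ka s2) x)"
      if "x \<in> {1..real D}" "zeta D W s2 x = 0" for x
      using round_root_best[OF that] .
    show "best_depth S" if "\<not> ?sign" "?endpoint S" for S using endpoint_best[OF that] .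
    show "(\<exists>!S. best_depth S) \<longleftrightarrow> tie_free" by (rule ex1_best_iff)
    show "\<exists>!S. best_depth S" if tie_free using ex1_best_iff that by simp
    show "\<exists>!x. x \<in> {1..real D} \<and> zeta D W s2 x = 0" if "tie_free" "best_depth S" "?sign" for S
      using root_case[OF that] by simp
    show "S = round_by (phi D W Ka s2) (THE x. x \<in> {1..real D} \<and> zeta D W s2 x = 0)"
      if "tie_free" "best_depth S" "?sign" for S
      using root_case[OF that] by simp
    show "?endpoint S' \<longleftrightarrow> S' = S" if "tie_free" "best_depth S" "\<not> ?sign" for S S'
      by (rule endpoint_case[OF that])
  qed
qed

end
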